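(* Let $r\in(0,\infty)$, $p\in(1,\infty)$, and $c,\alpha\in\mathbb{R}$. Then $e^{c|\cdot|^\alpha}\in A^{\mathrm{loc}}_p(r)$ if and only if $c=0$ or $\alpha\in[0,1]$.
   Context: The underlying space is $\mathbb{R}^n$, and $e^{c|\cdot|^\alpha}$ denotes the function $x\mapsto e^{c|x|^\alpha}$ (defined almost everywhere). Cubes have edges parallel to the coordinate axes; $\ell(Q)$ is the edge length of $Q$; $\fint_Qf:=\frac1{|Q|}\int_Qf$; $p':=\frac p{p-1}$. A scalar weight is a non-negative locally integrable function on $\mathbb{R}^n$ taking values in $(0,\infty)$ almost everywhere. $A_p^{\mathrm{loc}}(r)$ is the set of all scalar weights $w$ with $$[w]_{A_p^{\mathrm{loc}}(r)}:=\sup_{\mathrm{cubes}\ Q:\ \ell(Q)\le r}\fint_Qw(x)\,dx\left\{\fint_Q[w(x)]^{-\frac{p'}p}\,dx\right\}^{\frac p{p'}}<\infty.$$ *)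

theory Defs
  imports "HOL-Analysis.Analysis"
begin

text \<open>
  Cubes are taken closed; the faces have measure zero, so including them or not does not affect
  the averages below. All cubes occurring below have edge length \<open>l > 0\<close>.
\<close>
definition cube :: "real ^ 'n \<Rightarrow> real \<Rightarrow> (real ^ 'n) set" where
  "cube a l = cbox a (\<chi> i. a $ i + l)"

definition scalar_weight :: "(real ^ 'n \<Rightarrow> real) \<Rightarrow> bool" where
  "scalar_weight w \<longleftrightarrow>
     (\<forall>x. 0 \<le> w x) \<and> (\<forall>K. compact K \<longrightarrow> w absolutely_integrable_on K) \<and>
     (AE x in lebesgue. 0 < w x)"

definition conj_exponent :: "real \<Rightarrow> real" where
  "conj_exponent p = p / (p - 1)"

text \<open>
  Averages of non-negative functions are extended-valued: the average of \<open>w powr (- p' / p)\<close>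
  may be infinite, and then so is the constant of \<open>w\<close>. (The Bochner integral
  would return 0 in that case.)
\<close>
definition average :: "(real ^ 'n) set \<Rightarrow> (real ^ 'n \<Rightarrow> ennreal) \<Rightarrow> ennreal" where
  "average Q f = (\<integral>\<^sup>+x\<in>Q. f x \<partial>lebesgue) / emeasure lebesgue Q"

text \<open>Power with a positive real exponent on \<open>[0,\<infinity>]\<close>.\<close>
definition ennreal_powr :: "ennreal \<Rightarrow> real \<Rightarrow> ennreal" where
  "ennreal_powr x s = (if x = \<infinity> then \<infinity> else ennreal (enn2real x powr s))"

text \<open>
  The inner \<open>powr\<close> sends 0 to 0 whatever the exponent, but for a scalar weight
  \<open>w x = 0\<close> occurs only on a null set.
\<close>
definition Ap_loc_const :: "real \<Rightarrow> real \<Rightarrow> (real ^ 'n \<Rightarrow> real) \<Rightarrow> ennreal" where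
  "Ap_loc_const p r w =
     (SUP Q \<in> {cube a l | a l. 0 < l \<and> l \<le> r}.
        average Q (\<lambda>x. ennreal (w x)) *
        ennreal_powr (average Q (\<lambda>x. ennreal (w x powr (- (conj_exponent p / p)))))
          (p / conj_exponent p))"

definition Ap_loc :: "real \<Rightarrow> real \<Rightarrow> (real ^ 'n \<Rightarrow> real) set" where
  "Ap_loc p r = {w. scalar_weight w \<and> Ap_loc_const p r w < \<infinity>}"

text \<open>
  \<open>exp (c * \<bar>x\<bar>^\<alpha>)\<close>, with the Euclidean norm. At the single point \<open>x = 0\<close>, where the expression
  may be undefined, the value is 1 because \<open>0 powr \<alpha> = 0\<close>.
\<close>
definition exp_power :: "real \<Rightarrow> real \<Rightarrow> real ^ 'n \<Rightarrow> real" where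
  "exp_power c \<alpha> = (\<lambda>x. exp (c * norm x powr \<alpha>))"

end

theory Submission
  imports Defs "HOL-Real_Asymp.Real_Asymp"
begin

text \<open>
  Whether \<open>exp \<circ> u\<close> belongs to the local Muckenhoupt class is decided by the oscillation of \<open>u\<close> on
  cubes of edge length at most \<open>r\<close>.

  If \<open>u\<close> varies by at most \<open>M\<close> on each such cube \<open>Q\<close>, then, with \<open>a \<in> Q\<close>, the average of \<open>exp \<circ> u\<close>
  is at most \<open>exp (u a + M)\<close> and the power mean of its inverse is at most \<open>exp (M - u a)\<close>, so the
  product is at most \<open>exp (2 * M)\<close> (\<open>exp_in_Ap_loc\<close>). For \<open>0 \<le> \<alpha> \<le> 1\<close>, subadditivity of
  \<open>t \<mapsto> t powr \<alpha>\<close> bounds the oscillation of \<open>norm x powr \<alpha>\<close> by \<open>dist x y powr \<alpha>\<close>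
  (\<open>norm_powr_diff_le\<close>).

  Conversely, suppose that \<open>Q\<close> contains two cubes of a fixed proportion of its size such that
  \<open>u \<ge> A\<close> on one and \<open>u \<le> B\<close> on the other. Restricting each average to the appropriate subcube
  bounds the product below by a constant times \<open>exp (A - B)\<close> (\<open>Ap_loc_const_ge\<close>). This is applied
  to cubes with lowest corner \<open>(s, \<dots>, s)\<close> and edge length \<open>l\<close>, where two subcubes on the diagonal
  give \<open>A - B\<close> proportional to
  \<open>\<bar>(s + 3 * l / 4) powr \<alpha> - (s + l / 2) powr \<alpha>\<bar>\<close> (\<open>exp_power_Ap_loc_const_ge\<close>). For \<open>\<alpha> > 1\<close> this
  tends to infinity as \<open>s \<rightarrow> \<infinity>\<close> with \<open>l = r\<close>, and for \<open>\<alpha> < 0\<close> as \<open>l \<rightarrow> 0\<close> with \<open>s = 0\<close>. The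
  possible failure of local integrability at the origin therefore needs no separate treatment.
\<close>

section \<open>Cubes and averages\<close>

lemma mem_cube_iff: "x \<in> cube a l \<longleftrightarrow> (\<forall>i. a $ i \<le> x $ i \<and> x $ i \<le> a $ i + l)"
  by (simp add: cube_def mem_box_cart)

lemma emeasure_cube:
  fixes a :: "real ^ 'n"
  assumes "0 \<le> l"
  shows "emeasure lebesgue (cube a l) = ennreal (l ^ CARD('n))"
proof -
  have "a \<in> cube a l"
    using assms by (simp add: mem_cube_iff)
  then have "cbox a (\<chi> i. a $ i + l) \<noteq> {}"
    by (auto simp: cube_def)
  then have "measure lebesgue (cube a l) = l ^ CARD('n)"
    unfolding cube_def by (simp add: content_cbox_cart)
  moreover have "emeasure lebesgue (cube a l) = ennreal (measure lebesgue (cube a l))"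
    unfolding cube_def by (rule emeasure_eq_ennreal_measure) (simp add: emeasure_lborel_cbox_eq)
  ultimately show ?thesis by simp
qed

lemma cube_dist_le:
  fixes x y :: "real ^ 'n" and l :: real
  assumes "x \<in> cube a l" "y \<in> cube a l"
  shows "dist x y \<le> CARD('n) * l"
proof -
  have "\<bar>(x - y) $ i\<bar> \<le> l" for i
    using assms[unfolded mem_cube_iff, rule_format, of i] by auto
  then have "(\<Sum>i\<in>UNIV. \<bar>(x - y) $ i\<bar>) \<le> (\<Sum>i\<in>(UNIV :: 'n set). l)"
    by (intro sum_mono) auto
  then show ?thesis
    using norm_le_l1_cart[of "x - y"] by (simp add: dist_norm)
qed

text \<open>No measurability of \<open>f\<close> is needed here or in the next lemma: the non-negative integral is
  monotone on arbitrary functions.\<close>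

lemma average_le:
  fixes a :: "real ^ 'n"
  assumes "0 < l" "\<And>x. x \<in> cube a l \<Longrightarrow> f x \<le> C"
  shows "average (cube a l) f \<le> C"
proof -
  have "(\<integral>\<^sup>+x\<in>cube a l. f x \<partial>lebesgue) \<le> (\<integral>\<^sup>+x\<in>cube a l. C \<partial>lebesgue)"
    using assms by (intro nn_integral_mono) (auto simp: indicator_def)
  also have "\<dots> = C * emeasure lebesgue (cube a l)"
    by (rule nn_integral_cmult_indicator) (simp add: cube_def)
  finally have "average (cube a l) f \<le> C * emeasure lebesgue (cube a l) / emeasure lebesgue (cube a l)"
    unfolding average_def by (rule divide_right_mono_ennreal)
  also have "\<dots> = C"
    using assms by (simp add: emeasure_cube ennreal_mult_divide_eq)
  finally show ?thesis .
qed

lemma average_ge_subcube: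
  fixes a b :: "real ^ 'n"
  assumes "0 < k" "0 < l" "cube b k \<subseteq> cube a l" "0 \<le> m"
    and "\<And>x. x \<in> cube b k \<Longrightarrow> ennreal m \<le> f x"
  shows "ennreal ((k / l) ^ CARD('n) * m) \<le> average (cube a l) f"
proof -
  have "ennreal m * emeasure lebesgue (cube b k) = (\<integral>\<^sup>+x\<in>cube b k. ennreal m \<partial>lebesgue)"
    by (rule nn_integral_cmult_indicator[symmetric]) (simp add: cube_def)
  also have "\<dots> \<le> (\<integral>\<^sup>+x\<in>cube a l. f x \<partial>lebesgue)"
    using assms by (intro nn_integral_mono) (auto simp: indicator_def)
  finally have "ennreal m * emeasure lebesgue (cube b k) / emeasure lebesgue (cube a l) \<le> average (cube a l) f"
    unfolding average_def by (rule divide_right_mono_ennreal)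
  moreover have "ennreal m * emeasure lebesgue (cube b k) / emeasure lebesgue (cube a l)
      = ennreal ((k / l) ^ CARD('n) * m)"
    using assms
    by (simp add: emeasure_cube divide_ennreal power_divide mult.commute flip: ennreal_mult)
  ultimately show ?thesis by simp
qed

lemma ennreal_powr_ennreal [simp]: "0 \<le> y \<Longrightarrow> ennreal_powr (ennreal y) s = ennreal (y powr s)"
  by (simp add: ennreal_powr_def)

lemma ennreal_powr_mono:
  assumes "x \<le> y" "0 \<le> s"
  shows "ennreal_powr x s \<le> ennreal_powr y s"
proof (cases "y = \<infinity>")
  case False
  then have "x < \<infinity>" "y < \<infinity>"
    using assms by (auto simp: less_top top.not_eq_extremum)
  then show ?thesis
    using assms by (auto simp: ennreal_powr_def intro!: ennreal_leI powr_mono2 enn2real_mono)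
qed (simp add: ennreal_powr_def)

lemma conj_exponent_quotients:
  assumes "1 < p"
  shows "conj_exponent p / p = 1 / (p - 1)" "p / conj_exponent p = p - 1"
  using assms by (simp_all add: conj_exponent_def)

lemma Ap_loc_const_eq:
  assumes "1 < p"
  shows "Ap_loc_const p r w =
     (SUP Q \<in> {cube a l | a l. 0 < l \<and> l \<le> r}.
        average Q (\<lambda>x. ennreal (w x)) *
        ennreal_powr (average Q (\<lambda>x. ennreal (w x powr (- 1 / (p - 1))))) (p - 1))"
  unfolding Ap_loc_const_def conj_exponent_quotients[OF assms] by simp

section \<open>Exponentials of functions with bounded local oscillation\<close>

text \<open>The oscillation is bounded at every scale \<open>R\<close>, not only at the scale of the cubes, so that the
  hypothesis also yields boundedness on compact sets and hence local integrability.\<close>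

lemma exp_in_Ap_loc:
  fixes u :: "real ^ 'n \<Rightarrow> real"
  assumes "1 < p" and u: "u \<in> borel_measurable borel"
    and osc: "\<And>R. \<exists>M. \<forall>x y. dist x y \<le> R \<longrightarrow> \<bar>u x - u y\<bar> \<le> M"
  shows "(\<lambda>x. exp (u x)) \<in> Ap_loc p r"
proof -
  define w where "w = (\<lambda>x. exp (u x))"
  have [measurable]: "u \<in> borel_measurable lebesgue"
    using u by (simp add: measurable_completion)
  have "w absolutely_integrable_on K" if "compact K" for K
  proof -
    obtain R where R: "\<And>x. x \<in> K \<Longrightarrow> norm x \<le> R"
      using compact_imp_bounded[OF \<open>compact K\<close>] by (auto simp: bounded_iff)
    obtain M where M: "\<And>x. norm x \<le> R \<Longrightarrow> \<bar>u x - u 0\<bar> \<le> M"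
      using osc[of R] by (metis dist_0_norm dist_commute)
    have K: "K \<in> lmeasurable"
      using \<open>compact K\<close> by (simp add: lmeasurable_compact)
    have "w x \<le> exp (u 0 + M)" if "x \<in> K" for x
      using M[OF R[OF that]] by (simp add: w_def)
    then show ?thesis
      using K 
      by (intro measurable_bounded_by_integrable_imp_absolutely_integrable[where g = "\<lambda>_. exp (u 0 + M)"])
        (auto simp: w_def fmeasurableD integrable_on_const borel_measurable_if_D
          intro!: measurable_restrict_space1)
  qed
  then have "scalar_weight w"
    by (auto simp: scalar_weight_def w_def)
  moreover obtain M where M: "\<And>x y. dist x y \<le> CARD('n) * r \<Longrightarrow> \<bar>u x - u y\<bar> \<le> M"
    using osc[of "CARD('n) * r"] by metis
  have "Ap_loc_const p r w \<le> ennreal (exp (2 * M))"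
    unfolding Ap_loc_const_eq[OF \<open>1 < p\<close>]
  proof (rule SUP_least, safe)
    fix a :: "real ^ 'n" and l :: real
    assume l: "0 < l" "l \<le> r"
    define q where "q = 1 / (p - 1)"
    have q: "0 < q" "q * (p - 1) = 1"
      using \<open>1 < p\<close> by (auto simp: q_def)
    have "a \<in> cube a l"
      using l by (simp add: mem_cube_iff)
    have *: "\<bar>u x - u a\<bar> \<le> M" if "x \<in> cube a l" for x
    proof (rule M)
      have "real CARD('n) * l \<le> real CARD('n) * r"
        using l by (intro mult_left_mono) auto
      then show "dist x a \<le> CARD('n) * r"
        using cube_dist_le[OF that \<open>a \<in> cube a l\<close>] by linarith
    qed
    have 1: "average (cube a l) (\<lambda>x. ennreal (w x)) \<le> ennreal (exp (u a + M))"
      using * by (intro average_le l) (force simp: w_def intro!: ennreal_leI)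
    have "w x powr (- q) \<le> exp (q * (M - u a))" if "x \<in> cube a l" for x
    proof -
      have "q * (- u x) \<le> q * (M - u a)"
        using *[OF that] q by (intro mult_left_mono) auto
      then show ?thesis
        by (simp add: w_def powr_def mult.commute)
    qed
    then have "average (cube a l) (\<lambda>x. ennreal (w x powr (- q))) \<le> ennreal (exp (q * (M - u a)))"
      by (intro average_le l ennreal_leI)
    then have "ennreal_powr (average (cube a l) (\<lambda>x. ennreal (w x powr (- q)))) (p - 1)
        \<le> ennreal_powr (ennreal (exp (q * (M - u a)))) (p - 1)"
      using \<open>1 < p\<close> by (intro ennreal_powr_mono) auto
    also have "\<dots> = ennreal (exp (M - u a))"
      using q by (simp add: powr_def ac_simps)
    finally have "average (cube a l) (\<lambda>x. ennreal (w x))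
        * ennreal_powr (average (cube a l) (\<lambda>x. ennreal (w x powr (- q)))) (p - 1)
        \<le> ennreal (exp (u a + M)) * ennreal (exp (M - u a))"
      by (intro mult_mono 1) auto
    also have "\<dots> = ennreal (exp (2 * M))"
      by (simp flip: ennreal_mult exp_add)
    finally show "average (cube a l) (\<lambda>x. ennreal (w x))
        * ennreal_powr (average (cube a l) (\<lambda>x. ennreal (w x powr (- 1 / (p - 1))))) (p - 1)
        \<le> ennreal (exp (2 * M))"
      by (simp add: q_def)
  qed
  then have "Ap_loc_const p r w < \<infinity>"
    by (rule order.strict_trans1) simp
  ultimately show ?thesis
    by (simp add: Ap_loc_def w_def)
qed

lemma powr_add_le:
  fixes s t \<alpha> :: real
  assumes "0 \<le> \<alpha>" "\<alpha> \<le> 1" "0 \<le> s" "0 \<le> t"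
  shows "(s + t) powr \<alpha> \<le> s powr \<alpha> + t powr \<alpha>"
proof (cases "s = 0 \<or> t = 0")
  case False
  then have pos: "0 < s" "0 < t"
    using assms by auto
  have le: "y * (s + t) powr \<alpha> \<le> (y * (s + t)) powr \<alpha>" if "0 < y" "y \<le> 1" for y
  proof -
    have "y powr 1 \<le> y powr \<alpha>"
      using assms that by (intro powr_mono') auto
    then show ?thesis
      using that pos by (simp add: powr_mult mult_right_mono)
  qed
  have "(s + t) powr \<alpha> = s / (s + t) * (s + t) powr \<alpha> + t / (s + t) * (s + t) powr \<alpha>"
    using pos by (simp flip: distrib_right add_divide_distrib)
  also have "\<dots> \<le> (s / (s + t) * (s + t)) powr \<alpha> + (t / (s + t) * (s + t)) powr \<alpha>"
    using pos by (intro add_mono le) auto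
  also have "\<dots> = s powr \<alpha> + t powr \<alpha>"
    using pos by simp
  finally show ?thesis .
qed (use assms in auto)

lemma norm_powr_diff_le:
  fixes x y :: "'a :: real_normed_vector"
  assumes "0 \<le> \<alpha>" "\<alpha> \<le> 1"
  shows "\<bar>norm x powr \<alpha> - norm y powr \<alpha>\<bar> \<le> dist x y powr \<alpha>"
proof -
  have *: "norm x powr \<alpha> \<le> norm y powr \<alpha> + dist x y powr \<alpha>" for x y :: 'a
  proof -
    have "norm x powr \<alpha> \<le> (norm y + dist x y) powr \<alpha>"
      using assms norm_triangle_ineq[of y "x - y"] by (intro powr_mono2) (auto simp: dist_norm)
    also have "\<dots> \<le> norm y powr \<alpha> + dist x y powr \<alpha>"
      using assms by (intro powr_add_le) auto
    finally show ?thesis .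
  qed
  show ?thesis
    using *[of x y] *[of y x] by (simp add: dist_commute abs_le_iff)
qed

lemma exp_power_in_Ap_loc:
  assumes "1 < p" "0 \<le> \<alpha>" "\<alpha> \<le> 1"
  shows "(exp_power c \<alpha> :: real ^ 'n \<Rightarrow> real) \<in> Ap_loc p r"
  unfolding exp_power_def
proof (rule exp_in_Ap_loc[OF \<open>1 < p\<close>])
  fix R :: real
  have "\<bar>c * norm x powr \<alpha> - c * norm y powr \<alpha>\<bar> \<le> \<bar>c\<bar> * R powr \<alpha>"
    if "dist x y \<le> R" for x y :: "real ^ 'n"
  proof -
    have "\<bar>norm x powr \<alpha> - norm y powr \<alpha>\<bar> \<le> R powr \<alpha>"
      using norm_powr_diff_le[OF assms(2,3), of x y] powr_mono2[OF assms(2) zero_le_dist that]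
      by linarith
    then show ?thesis
      by (simp add: abs_mult mult_left_mono flip: right_diff_distrib)
  qed
  then show "\<exists>M. \<forall>x y :: real ^ 'n. dist x y \<le> R \<longrightarrow> \<bar>c * norm x powr \<alpha> - c * norm y powr \<alpha>\<bar> \<le> M"
    by blast
qed measurable

section \<open>Unbounded oscillation of the exponent\<close>

text \<open>The averages may be restricted to the subcubes because all integrands are non-negative. The
  proportion of volume \<open>(k / l) ^ CARD('n)\<close> of the subcubes enters once from the average of \<open>w\<close> and
  with the exponent \<open>p - 1\<close> from the other factor, which gives the exponent \<open>p\<close>.\<close>

lemma Ap_loc_const_ge:
  fixes w :: "real ^ 'n \<Rightarrow> real"
  assumes "1 < p" "0 < k" "0 < l" "l \<le> r"
    and sub: "cube b k \<subseteq> cube a l" "cube b' k \<subseteq> cube a l"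
    and lower: "\<And>x. x \<in> cube b k \<Longrightarrow> exp A \<le> w x"
    and upper: "\<And>x. x \<in> cube b' k \<Longrightarrow> 0 < w x \<and> w x \<le> exp B"
  shows "ennreal (((k / l) ^ CARD('n)) powr p * exp (A - B)) \<le> Ap_loc_const p r w"
proof -
  define q where "q = 1 / (p - 1)"
  have q: "0 < q" "q * (p - 1) = 1"
    using \<open>1 < p\<close> by (auto simp: q_def)
  define \<kappa> where "\<kappa> = (k / l) ^ CARD('n)"
  have "0 < \<kappa>"
    using assms by (simp add: \<kappa>_def)
  have 1: "ennreal (\<kappa> * exp A) \<le> average (cube a l) (\<lambda>x. ennreal (w x))"
    unfolding \<kappa>_def using assms by (intro average_ge_subcube[of _ _ b] ennreal_leI) auto
  have "exp (- q * B) \<le> w x powr (- q)" if "x \<in> cube b' k" for x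
  proof -
    have "exp B powr (- q) \<le> w x powr (- q)"
      using upper[OF that] q by (intro powr_mono2') auto
    then show ?thesis
      by (simp add: powr_def)
  qed
  then have "ennreal (\<kappa> * exp (- q * B)) \<le> average (cube a l) (\<lambda>x. ennreal (w x powr (- q)))"
    unfolding \<kappa>_def using assms by (intro average_ge_subcube[of _ _ b'] ennreal_leI) auto
  then have "ennreal_powr (ennreal (\<kappa> * exp (- q * B))) (p - 1)
      \<le> ennreal_powr (average (cube a l) (\<lambda>x. ennreal (w x powr (- q)))) (p - 1)"
    using \<open>1 < p\<close> by (intro ennreal_powr_mono) auto
  moreover have "(\<kappa> * exp (- q * B)) powr (p - 1) = \<kappa> powr (p - 1) * exp (- B)"
  proof -
    have "exp (- q * B) powr (p - 1) = exp (- (q * (p - 1)) * B)"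
      by (simp add: powr_def algebra_simps)
    then show ?thesis
      using \<open>0 < \<kappa>\<close> q by (simp add: powr_mult)
  qed
  ultimately have 2: "ennreal (\<kappa> powr (p - 1) * exp (- B))
      \<le> ennreal_powr (average (cube a l) (\<lambda>x. ennreal (w x powr (- q)))) (p - 1)"
    using \<open>0 < \<kappa>\<close> by simp
  have "\<kappa> powr p = \<kappa> * \<kappa> powr (p - 1)"
    using \<open>0 < \<kappa>\<close> by (simp add: powr_mult_base)
  then have "ennreal (\<kappa> powr p * exp (A - B)) = ennreal (\<kappa> * exp A) * ennreal (\<kappa> powr (p - 1) * exp (- B))"
    using \<open>0 < \<kappa>\<close> by (simp add: exp_diff exp_minus field_simps flip: ennreal_mult)
  also have "\<dots> \<le> average (cube a l) (\<lambda>x. ennreal (w x))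
      * ennreal_powr (average (cube a l) (\<lambda>x. ennreal (w x powr (- q)))) (p - 1)"
    by (intro mult_mono 1 2) auto
  also have "\<dots> \<le> Ap_loc_const p r w"
    unfolding Ap_loc_const_eq[OF \<open>1 < p\<close>] q_def
    using assms by (intro SUP_upper2[of "cube a l"]) auto
  finally show ?thesis
    by (simp add: \<kappa>_def)
qed

lemma norm_const_vec: "norm ((\<chi> i. t) :: real ^ 'n) = sqrt CARD('n) * \<bar>t\<bar>"
  by (simp add: norm_vec_def L2_set_def real_sqrt_mult)

text \<open>The lowest and highest corners of a cube in the positive orthant are its points of least and
  greatest norm.\<close>

lemma norm_diagonal_cube:
  fixes x :: "real ^ 'n"
  assumes "x \<in> cube (\<chi> i. s) k" "0 \<le> s"
  shows "sqrt CARD('n) * s \<le> norm x" "norm x \<le> sqrt CARD('n) * (s + k)"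
proof -
  have x: "s \<le> x $ i" "x $ i \<le> s + k" for i
    using assms by (auto simp: mem_cube_iff)
  have pos: "0 \<le> x $ i" for i
    using x(1)[of i] assms by linarith
  have nonneg: "0 \<le> s + k"
    using x(2)[of undefined] pos[of undefined] by linarith
  have "norm ((\<chi> i. s) :: real ^ 'n) \<le> norm x"
    using x pos assms by (intro norm_le_componentwise_cart) simp
  moreover have "norm x \<le> norm ((\<chi> i. s + k) :: real ^ 'n)"
    using x pos nonneg by (intro norm_le_componentwise_cart) simp
  ultimately show "sqrt CARD('n) * s \<le> norm x" "norm x \<le> sqrt CARD('n) * (s + k)"
    using assms nonneg by (simp_all add: norm_const_vec)
qed

lemma mult_powr_mono:
  fixes c \<alpha> :: real
  assumes "0 \<le> c * \<alpha>" "0 < s" "s \<le> t"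
  shows "c * s powr \<alpha> \<le> c * t powr \<alpha>"
proof -
  consider "0 \<le> c" "0 \<le> \<alpha>" | "c \<le> 0" "\<alpha> \<le> 0"
    using assms by (auto simp: zero_le_mult_iff)
  then show ?thesis
  proof cases
    case 1
    then show ?thesis
      using assms by (intro mult_left_mono powr_mono2) auto
  next
    case 2
    then show ?thesis
      using assms by (intro mult_left_mono_neg powr_mono2') auto
  qed
qed

text \<open>
  In the cube with corner \<open>(s, \<dots>, s)\<close> and edge length \<open>l\<close>, the two subcubes of edge length \<open>l / 4\<close>
  have their coordinates in \<open>[s + l / 4, s + l / 2]\<close> and in \<open>[s + 3 * l / 4, s + l]\<close>. The gap between
  them makes the exponent differ, and both avoid the origin even when \<open>s = 0\<close>, so that
  neither the convention \<open>0 powr \<alpha> = 0\<close> nor the singularity for \<open>\<alpha> < 0\<close> interferes.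
\<close>

lemma exp_power_Ap_loc_const_ge:
  fixes s l :: real
  assumes "1 < p" "0 \<le> s" "0 < l" "l \<le> r"
  shows "ennreal (((1 / 4) ^ CARD('n)) powr p *
      exp (\<bar>c\<bar> * sqrt CARD('n) powr \<alpha> * \<bar>(s + 3 * l / 4) powr \<alpha> - (s + l / 2) powr \<alpha>\<bar>))
    \<le> Ap_loc_const p r (exp_power c \<alpha> :: real ^ 'n \<Rightarrow> real)"
proof -
  define N where "N = sqrt CARD('n)"
  have N: "0 < N"
    by (simp add: N_def)
  define lo hi :: "real ^ 'n" where "lo = (\<chi> i. s + l / 4)" and "hi = (\<chi> i. s + 3 * l / 4)"
  define t1 t2 where "t1 = N * (s + l / 2)" and "t2 = N * (s + 3 * l / 4)"
  have t: "0 < t1" "t1 \<le> t2"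
    using assms N by (auto simp: t1_def t2_def)
  have lo: "0 < norm x \<and> norm x \<le> t1" if "x \<in> cube lo (l / 4)" for x
  proof -
    have "N * (s + l / 4) \<le> norm x" "norm x \<le> t1"
      using norm_diagonal_cube[of x "s + l / 4" "l / 4"] that assms
      by (auto simp: lo_def N_def t1_def add.commute)
    moreover have "0 < N * (s + l / 4)"
      using N assms by simp
    ultimately show ?thesis by linarith
  qed
  have hi: "t2 \<le> norm x" if "x \<in> cube hi (l / 4)" for x
    using norm_diagonal_cube(1)[of x "s + 3 * l / 4" "l / 4"] that assms
    by (auto simp: hi_def N_def t2_def)
  have sub: "cube lo (l / 4) \<subseteq> cube (\<chi> i. s) l" "cube hi (l / 4) \<subseteq> cube (\<chi> i. s) l"
  proof -
    have "x \<in> cube (\<chi> i. s) l" if "x \<in> cube lo (l / 4) \<or> x \<in> cube hi (l / 4)" for x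
      unfolding mem_cube_iff
    proof
      fix i
      have "(s + l / 4 \<le> x $ i \<and> x $ i \<le> s + l / 4 + l / 4) \<or>
          (s + 3 * l / 4 \<le> x $ i \<and> x $ i \<le> s + 3 * l / 4 + l / 4)"
        using that by (auto simp: mem_cube_iff lo_def hi_def)
      then show "(\<chi> i. s) $ i \<le> x $ i \<and> x $ i \<le> (\<chi> i. s) $ i + l"
        using assms by auto
    qed
    then show "cube lo (l / 4) \<subseteq> cube (\<chi> i. s) l" "cube hi (l / 4) \<subseteq> cube (\<chi> i. s) l"
      by auto
  qed
  have "ennreal (((l / 4 / l) ^ CARD('n)) powr p * exp \<bar>c * t2 powr \<alpha> - c * t1 powr \<alpha>\<bar>)
      \<le> Ap_loc_const p r (exp_power c \<alpha> :: real ^ 'n \<Rightarrow> real)"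
    \<comment> \<open>The exponent is radially monotone; the sign of \<open>c * \<alpha>\<close> decides on which subcube it is larger.\<close>
  proof (cases "0 \<le> c * \<alpha>")
    case True
    have "c * norm x powr \<alpha> \<le> c * t1 powr \<alpha>" if "x \<in> cube lo (l / 4)" for x
      using lo[OF that] mult_powr_mono[OF True] by auto
    moreover have "c * t2 powr \<alpha> \<le> c * norm x powr \<alpha>" if "x \<in> cube hi (l / 4)" for x
      using hi[OF that] t mult_powr_mono[OF True] by auto
    moreover have "c * t1 powr \<alpha> \<le> c * t2 powr \<alpha>"
      using t mult_powr_mono[OF True] by auto
    ultimately show ?thesis
      using assms sub Ap_loc_const_ge[of p "l / 4" l r hi "\<chi> i. s" lo "c * t2 powr \<alpha>"
          "exp_power c \<alpha>" "c * t1 powr \<alpha>"]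
      by (simp add: exp_power_def)
  next
    case False
    then have neg: "0 \<le> (- c) * \<alpha>" by simp
    have "c * t1 powr \<alpha> \<le> c * norm x powr \<alpha>" if "x \<in> cube lo (l / 4)" for x
      using lo[OF that] mult_powr_mono[OF neg, of "norm x" t1] by auto
    moreover have "c * norm x powr \<alpha> \<le> c * t2 powr \<alpha>" if "x \<in> cube hi (l / 4)" for x
      using hi[OF that] t mult_powr_mono[OF neg, of t2 "norm x"] by auto
    moreover have "c * t2 powr \<alpha> \<le> c * t1 powr \<alpha>"
      using t mult_powr_mono[OF neg, of t1 t2] by auto
    ultimately show ?thesis
      using assms sub Ap_loc_const_ge[of p "l / 4" l r lo "\<chi> i. s" hi "c * t1 powr \<alpha>"
          "exp_power c \<alpha>" "c * t2 powr \<alpha>"]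
      by (simp add: exp_power_def)
  qed
  moreover have "\<bar>c * t2 powr \<alpha> - c * t1 powr \<alpha>\<bar>
      = \<bar>c\<bar> * N powr \<alpha> * \<bar>(s + 3 * l / 4) powr \<alpha> - (s + l / 2) powr \<alpha>\<bar>"
  proof -
    have "c * t2 powr \<alpha> - c * t1 powr \<alpha>
        = c * N powr \<alpha> * ((s + 3 * l / 4) powr \<alpha> - (s + l / 2) powr \<alpha>)"
      using N assms by (simp add: t1_def t2_def powr_mult right_diff_distrib)
    then show ?thesis
      by (simp add: abs_mult)
  qed
  ultimately show ?thesis
    using assms by (simp add: N_def)
qed

text \<open>The filter \<open>F\<close> describes how the diagonal cubes vary, so that both cubes moving to infinity and
  cubes shrinking to the origin are covered.\<close>

lemma exp_power_notin_Ap_loc: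
  fixes s l :: "'b \<Rightarrow> real"
  assumes "1 < p" "c \<noteq> 0" "F \<noteq> bot"
    and sl: "eventually (\<lambda>x. 0 \<le> s x \<and> 0 < l x \<and> l x \<le> r) F"
    and lim: "filterlim (\<lambda>x. (s x + 3 * l x / 4) powr \<alpha> - (s x + l x / 2) powr \<alpha>) at_infinity F"
  shows "(exp_power c \<alpha> :: real ^ 'n \<Rightarrow> real) \<notin> Ap_loc p r"
proof
  assume "(exp_power c \<alpha> :: real ^ 'n \<Rightarrow> real) \<in> Ap_loc p r"
  then have "Ap_loc_const p r (exp_power c \<alpha> :: real ^ 'n \<Rightarrow> real) < top"
    by (simp add: Ap_loc_def)
  then obtain C where C: "0 \<le> C" "Ap_loc_const p r (exp_power c \<alpha> :: real ^ 'n \<Rightarrow> real) = ennreal C"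
    by (cases "Ap_loc_const p r (exp_power c \<alpha> :: real ^ 'n \<Rightarrow> real)") auto
  define K where "K = ((1 / 4) ^ CARD('n)) powr p"
  define D where "D = \<bar>c\<bar> * sqrt CARD('n) powr \<alpha>"
  define g where "g x = \<bar>(s x + 3 * l x / 4) powr \<alpha> - (s x + l x / 2) powr \<alpha>\<bar>" for x
  have pos: "0 < K" "0 < D"
    using \<open>c \<noteq> 0\<close> by (auto simp: K_def D_def)
  have "filterlim g at_top F"
    using filterlim_at_infinity_imp_norm_at_top[OF lim] by (simp add: g_def [abs_def])
  then have "filterlim (\<lambda>x. K * exp (D * g x)) at_top F"
    using pos
    by (intro filterlim_tendsto_pos_mult_at_top[OF tendsto_const] filterlim_compose[OF exp_at_top])
  then have "eventually (\<lambda>x. C < K * exp (D * g x)) F"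
    by (simp add: filterlim_at_top_dense)
  moreover have "eventually (\<lambda>x. K * exp (D * g x) \<le> C) F"
    using sl
  proof eventually_elim
    case (elim x)
    then have "ennreal (K * exp (D * g x)) \<le> ennreal C"
      using exp_power_Ap_loc_const_ge[OF \<open>1 < p\<close>, of "s x" "l x" r c \<alpha>, where 'n = 'n] C
      by (simp add: K_def D_def g_def)
    then show ?case
      using C by (simp add: ennreal_le_iff)
  qed
  ultimately have "eventually (\<lambda>x. False) F"
    by eventually_elim linarith
  then show False
    using \<open>F \<noteq> bot\<close> by simp
qed

theorem proposition2p3:
  fixes r p c \<alpha> :: real
  assumes "0 < r" and "1 < p"
  shows "(exp_power c \<alpha> :: real ^ 'n \<Rightarrow> real) \<in> Ap_loc p r \<longleftrightarrow> c = 0 \<or> \<alpha> \<in> {0..1}"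
proof
  assume *: "(exp_power c \<alpha> :: real ^ 'n \<Rightarrow> real) \<in> Ap_loc p r"
  show "c = 0 \<or> \<alpha> \<in> {0..1}"
  proof (rule ccontr)
    assume "\<not> (c = 0 \<or> \<alpha> \<in> {0..1})"
    then consider "c \<noteq> 0" "1 < \<alpha>" | "c \<noteq> 0" "\<alpha> < 0"
      by force
    then show False
    proof cases
      case 1
      have "filterlim (\<lambda>s. (s + 3 * r / 4) powr \<alpha> - (s + r / 2) powr \<alpha>) at_top at_top"
        using \<open>1 < \<alpha>\<close> \<open>0 < r\<close> by real_asymp
      then have "filterlim (\<lambda>s. (s + 3 * r / 4) powr \<alpha> - (s + r / 2) powr \<alpha>) at_infinity at_top"
        by (rule filterlim_at_top_imp_at_infinity)
      moreover have "eventually (\<lambda>s :: real. 0 \<le> s \<and> 0 < r \<and> r \<le> r) at_top"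
        using eventually_ge_at_top[of "0 :: real"] \<open>0 < r\<close> by simp
      ultimately show False
        using * \<open>1 < p\<close> \<open>c \<noteq> 0\<close> trivial_limit_at_top_linorder
          exp_power_notin_Ap_loc[of p c at_top "\<lambda>s. s" "\<lambda>_. r" r \<alpha>, where 'n = 'n]
        by blast
    next
      case 2
      \<comment> \<open>Here \<open>s = 0\<close>, and the difference of powers is homogeneous of degree \<open>\<alpha>\<close> in \<open>l\<close>.\<close>
      define k where "k = (3 / 4) powr \<alpha> - (1 / 2) powr \<alpha>"
      have "k < 0"
        using 2 by (simp add: k_def powr_less_mono2_neg)
      then have "filterlim (\<lambda>l. k * l powr \<alpha>) at_bot (at_right 0)"
        using 2 by real_asymp
      then have lim: "filterlim (\<lambda>l. k * l powr \<alpha>) at_infinity (at_right 0)"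
        by (rule filterlim_at_bot_imp_at_infinity)
      have "eventually (\<lambda>l. k * l powr \<alpha> = (0 + 3 * l / 4) powr \<alpha> - (0 + l / 2) powr \<alpha>) (at_right 0)"
        using eventually_at_right_less[of "0 :: real"]
      proof eventually_elim
        case (elim l)
        then show ?case
          using powr_mult[of "3 / 4" l \<alpha>] powr_mult[of "1 / 2" l \<alpha>]
          by (simp add: k_def algebra_simps)
      qed
      then have "filterlim (\<lambda>l. (0 + 3 * l / 4) powr \<alpha> - (0 + l / 2) powr \<alpha>) at_infinity (at_right 0)"
        by (rule filterlim_cong[OF refl refl, THEN iffD1, OF _ lim])
      moreover have "eventually (\<lambda>l. (0::real) \<le> 0 \<and> 0 < l \<and> l \<le> r) (at_right 0)"
        using eventually_at_rightI[of 0 r "\<lambda>l. 0 < l \<and> l \<le> r"] \<open>0 < r\<close> by auto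
      ultimately show False
        using * \<open>1 < p\<close> \<open>c \<noteq> 0\<close> trivial_limit_at_right_real
          exp_power_notin_Ap_loc[of p c "at_right 0" "\<lambda>_. 0" "\<lambda>l. l" r \<alpha>, where 'n = 'n]
        by blast
    qed
  qed
next
  \<comment> \<open>If \<open>c = 0\<close>, then \<open>\<alpha>\<close> is arbitrary, but it may be replaced by \<open>0\<close>.\<close>
  have "(exp_power 0 \<alpha> :: real ^ 'n \<Rightarrow> real) = exp_power 0 0"
    by (simp add: exp_power_def)
  moreover assume "c = 0 \<or> \<alpha> \<in> {0..1}"
  ultimately show "(exp_power c \<alpha> :: real ^ 'n \<Rightarrow> real) \<in> Ap_loc p r"
    using exp_power_in_Ap_loc[OF \<open>1 < p\<close>] by (metis atLeastAtMost_iff order_refl zero_le_one)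
qed

end
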